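(* Assume that for each $i\in\mathcal H$: (a) $\mathcal X_i\subseteq\mathbb R^{n_i}$ is nonempty, closed and convex, $Q_i\in\mathbb R^{n_i\times n_i}$ is symmetric positive semidefinite, $q_i\in\mathbb R^{n_i}$, the function $$\phi_i(z_i)=\tfrac12 z_i^\top Q_i z_i+q_i^\top z_i+I_{\mathcal X_i}(z_i)$$ is proper, closed and convex, and the price enters the follower objective affinely through the term $\lambda_i(\delta_i)^\top z_i$; and (b) for every $\delta\in\mathcal D$ the follower problem $\min_{z_i\in\mathbb R^{n_i}}\{\phi_i(z_i)+\lambda_i(\delta_i)^\top z_i\}$ has at least one optimal solution. Then for any $i\in\mathcal H$ and any pair $(x_i,\delta_i)$ the following are equivalent: 1. $x_i\in\operatorname{argmin}_{z_i\in\mathbb R^{n_i}}\{\phi_i(z_i)+\lambda_i(\delta_i)^\top z_i\}$. 2. $-\lambda_i(\delta_i)\in\partial\phi_i(x_i)$. 3. $D_{\phi_i}(x_i,-\lambda_i(\delta_i))=0$, i.e. $\phi_i(x_i)+\phi_i^*(-\lambda_i(\delta_i))+\lambda_i(\delta_i)^\top x_i=0$. Consequently, the bilevel problem $$\min_{x,\ \delta\in\mathcal D} F(x,\delta)\quad\text{s.t.}\quad x_i\in\operatorname{argmin}_{z_i\in\mathbb R^{n_i}}\{\phi_i(z_i)+\lambda_i(\delta_i)^\top z_i\}\ \ \forall i\in\mathcal H$$ is equivalent to the single-level problem $$\min_{x,\delta} F(x,\delta)\quad\text{s.t.}\quad \delta\in\mathcal D,\qquad D_{\phi_i}(x_i,-\lambda_i(\delta_i))=0\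 \ \forall i\in\mathcal H,$$ in the sense that the two problems have the same feasible pairs $(x,\delta)$ and the same objective (hence the same optimal value and the same optimal solutions).
   Context: $\mathcal H$ is a finite set of followers (hubs) and $\mathcal T$ a finite set of time periods. The leader's variable is $\delta=(\delta_i)_{i\in\mathcal H}$ with $\delta_i=(\delta_{it})_{t\in\mathcal T}\in\mathbb R^{\mathcal T}$, constrained to an admissible price set $\mathcal D$ (a box $\underline\delta_i\le\delta_{it}\le\bar\delta_i$ for all $i,t$, possibly with further convex constraints). Follower $i$ has response $x_i\in\mathbb R^{n_i}$, and $x=(x_i)_{i\in\mathcal H}$. For each $i$, $\delta_i\mapsto\lambda_i(\delta_i)\in\mathbb R^{n_i}$ is an affine map (the vector of price-induced linear coefficients). $F(x,\delta)$ is the leader's objective. $I_{\mathcal X}$ is the indicator function: $I_{\mathcal X}(x)=0$ if $x\in\mathcal X$ and $+\infty$ otherwise. For a proper function $\phi:\mathbb R^n\to\mathbb R\cup\{+\infty\}$, the convex conjugate is $\phi^*(y)=\sup_{x\in\mathbb R^n}\{y^\top x-\phi(x)\}$; the subdifferential at $x\in\operatorname{dom}\phi$ is $\partial\phi(x)=\{y:\phi(z)\ge\phi(x)+y^\top(z-x)\ \forall z\in\mathbb R^n\}$ (and is empty for $x\notin\operatorname{dom}\phi$). The Fenchel--Young divergence is $D_\phi(x,y)=\phi(x)+\phi^*(y)-y^\top x\in[0,+\infty]$. *)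

theory Defs
  imports "HOL-Analysis.Analysis" "Jordan_Normal_Form.Matrix"
begin

text \<open>
  The response spaces have different dimensions \<open>n i\<close>, so their elements are represented
  by the vectors in \<open>carrier_vec (n i)\<close>.  The syntax \<open>$\<close> and \<open>\<bullet>\<close> refers to these
  vectors from here on, not to \<open>vec_nth\<close> and \<open>inner\<close>.
\<close>

unbundle no vec_syntax and no inner_syntax

text \<open>The Euclidean topology of the library lives on zero-padded sequences.\<close>

definition vec_topology :: "nat \<Rightarrow> real Matrix.vec topology" where
  "vec_topology n =
     pullback_topology (carrier_vec n) (\<lambda>x j. if j < n then x $ j else 0) (Euclidean_space n)"

lemma topspace_vec_topology [simp]: "topspace (vec_topology n) = carrier_vec n"
  by (auto simp: vec_topology_def topspace_pullback_topology topspace_Euclidean_space)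

definition convex_vec_set :: "real Matrix.vec set \<Rightarrow> bool" where
  "convex_vec_set X \<longleftrightarrow>
     (\<forall>x\<in>X. \<forall>y\<in>X. \<forall>u\<ge>0. \<forall>v\<ge>0. u + v = 1 \<longrightarrow> u \<cdot>\<^sub>v x + v \<cdot>\<^sub>v y \<in> X)"

definition psd_mat :: "nat \<Rightarrow> real mat \<Rightarrow> bool" where
  "psd_mat n Q \<longleftrightarrow> Q \<in> carrier_mat n n \<and> transpose_mat Q = Q \<and>
     (\<forall>z\<in>carrier_vec n. 0 \<le> z \<bullet> (Q *\<^sub>v z))"

definition affine_map :: "nat \<Rightarrow> ('a::real_vector \<Rightarrow> real Matrix.vec) \<Rightarrow> bool" where
  "affine_map n L \<longleftrightarrow> (\<forall>a. L a \<in> carrier_vec n) \<and>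
     (\<forall>a b u v. u + v = 1 \<longrightarrow> L (u *\<^sub>R a + v *\<^sub>R b) = u \<cdot>\<^sub>v L a + v \<cdot>\<^sub>v L b)"

definition price_box :: "('h \<Rightarrow> real) \<Rightarrow> ('h \<Rightarrow> real) \<Rightarrow> ((real ^ 't::finite) ^ 'h::finite) set" where
  "price_box lo hi = {\<delta>. \<forall>i t. lo i \<le> vec_nth (vec_nth \<delta> i) t \<and> vec_nth (vec_nth \<delta> i) t \<le> hi i}"

subsection \<open>Extended-real-valued functions\<close>

text \<open>
  A function on \<open>n\<close>-space is a function on all vectors of which only the values on
  \<open>carrier_vec n\<close> matter.
\<close>

definition indicator_fn :: "real Matrix.vec set \<Rightarrow> real Matrix.vec \<Rightarrow> ereal" where
  "indicator_fn X x = (if x \<in> X then 0 else \<infinity>)"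

definition proper_fn :: "nat \<Rightarrow> (real Matrix.vec \<Rightarrow> ereal) \<Rightarrow> bool" where
  "proper_fn n \<phi> \<longleftrightarrow>
     (\<forall>x\<in>carrier_vec n. \<phi> x \<noteq> -\<infinity>) \<and> (\<exists>x\<in>carrier_vec n. \<phi> x \<noteq> \<infinity>)"

definition closed_fn :: "nat \<Rightarrow> (real Matrix.vec \<Rightarrow> ereal) \<Rightarrow> bool" where
  "closed_fn n \<phi> \<longleftrightarrow>
     closedin (prod_topology (vec_topology n) euclideanreal)
       {(x, t). x \<in> carrier_vec n \<and> \<phi> x \<le> ereal t}"

definition convex_fn :: "nat \<Rightarrow> (real Matrix.vec \<Rightarrow> ereal) \<Rightarrow> bool" where
  "convex_fn n \<phi> \<longleftrightarrow>
     (\<forall>x\<in>carrier_vec n. \<forall>y\<in>carrier_vec n. \<forall>u\<ge>0. \<forall>v\<ge>0. u + v = 1 \<longrightarrow>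
        \<phi> (u \<cdot>\<^sub>v x + v \<cdot>\<^sub>v y) \<le> ereal u * \<phi> x + ereal v * \<phi> y)"

definition conjugate_fn :: "nat \<Rightarrow> (real Matrix.vec \<Rightarrow> ereal) \<Rightarrow> real Matrix.vec \<Rightarrow> ereal" where
  "conjugate_fn n \<phi> y = (SUP x\<in>carrier_vec n. ereal (y \<bullet> x) - \<phi> x)"

definition subdifferential ::
    "nat \<Rightarrow> (real Matrix.vec \<Rightarrow> ereal) \<Rightarrow> real Matrix.vec \<Rightarrow> real Matrix.vec set" where
  "subdifferential n \<phi> x =
     {y \<in> carrier_vec n. x \<in> carrier_vec n \<and> \<phi> x < \<infinity> \<and>
        (\<forall>z\<in>carrier_vec n. \<phi> z \<ge> \<phi> x + ereal (y \<bullet> (z - x)))}"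

definition fenchel_young_div ::
    "nat \<Rightarrow> (real Matrix.vec \<Rightarrow> ereal) \<Rightarrow> real Matrix.vec \<Rightarrow> real Matrix.vec \<Rightarrow> ereal" where
  "fenchel_young_div n \<phi> x y = \<phi> x + conjugate_fn n \<phi> y - ereal (y \<bullet> x)"

subsection \<open>Optimization problems\<close>

definition argmin_set :: "'a set \<Rightarrow> ('a \<Rightarrow> 'b::linorder) \<Rightarrow> 'a set" where
  "argmin_set S f = {x. is_arg_min f (\<lambda>z. z \<in> S) x}"

definition optimal_value :: "'a set \<Rightarrow> ('a \<Rightarrow> real) \<Rightarrow> ereal" where
  "optimal_value S f = (INF x\<in>S. ereal (f x))"

definition follower_cost ::
    "real Matrix.vec set \<Rightarrow> real mat \<Rightarrow> real Matrix.vec \<Rightarrow> real Matrix.vec \<Rightarrow> ereal" where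
  "follower_cost X Q q z = ereal (1 / 2 * (z \<bullet> (Q *\<^sub>v z)) + q \<bullet> z) + indicator_fn X z"

definition follower_argmin ::
    "nat \<Rightarrow> (real Matrix.vec \<Rightarrow> ereal) \<Rightarrow> real Matrix.vec \<Rightarrow> real Matrix.vec set" where
  "follower_argmin n \<phi> l = argmin_set (carrier_vec n) (\<lambda>z. \<phi> z + ereal (l \<bullet> z))"

definition bilevel_feasible ::
    "('h \<Rightarrow> nat) \<Rightarrow> ('h \<Rightarrow> real Matrix.vec \<Rightarrow> ereal) \<Rightarrow> ('h \<Rightarrow> real ^ 't \<Rightarrow> real Matrix.vec) \<Rightarrow>
     ((real ^ 't::finite) ^ 'h::finite) set \<Rightarrow> (('h \<Rightarrow> real Matrix.vec) \<times> ((real ^ 't) ^ 'h)) set" where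
  "bilevel_feasible n \<phi> lam D =
     {(x, \<delta>). (\<forall>i. x i \<in> carrier_vec (n i)) \<and> \<delta> \<in> D \<and>
        (\<forall>i. x i \<in> follower_argmin (n i) (\<phi> i) (lam i (vec_nth \<delta> i)))}"

definition single_level_feasible ::
    "('h \<Rightarrow> nat) \<Rightarrow> ('h \<Rightarrow> real Matrix.vec \<Rightarrow> ereal) \<Rightarrow> ('h \<Rightarrow> real ^ 't \<Rightarrow> real Matrix.vec) \<Rightarrow>
     ((real ^ 't::finite) ^ 'h::finite) set \<Rightarrow> (('h \<Rightarrow> real Matrix.vec) \<times> ((real ^ 't) ^ 'h)) set" where
  "single_level_feasible n \<phi> lam D =
     {(x, \<delta>). (\<forall>i. x i \<in> carrier_vec (n i)) \<and> \<delta> \<in> D \<and>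
        (\<forall>i. fenchel_young_div (n i) (\<phi> i) (x i) (- lam i (vec_nth \<delta> i)) = 0)}"

end

theory Submission
  imports Defs
begin

text \<open>
  All three optimality conditions say that \<open>x\<close> maximizes the gain
  \<open>z \<mapsto> y \<bullet> z - \<phi> z\<close> at the slope \<open>y = -\<lambda>\<close>.  The follower minimizes exactly the negative of
  this gain.  The subgradient inequality is the maximality inequality with its terms rearranged.
  The conjugate \<open>\<phi>\<^sup>*(y)\<close> is the supremum of the gain, so the Fenchel--Young divergence is the gap
  between this supremum and the gain at \<open>x\<close>, and it vanishes precisely when the supremum is
  attained at \<open>x\<close>.

  What needs care is infinite values.  Properness provides a point of finite cost, so the
  supremum is above \<open>-\<infinity>\<close> and no point outside the domain of \<open>\<phi>\<close> can be a maximizer; the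
  subdifferential is empty there and the divergence is \<open>\<infinity>\<close>.  On the domain, \<open>\<phi> x\<close> is a real
  number and can be moved from one side of an inequality to the other.

  Since the conditions agree for each follower, the bilevel and the single-level problem have
  the same feasible set, and then also the same optimal value and the same solutions.
\<close>

text \<open>A linear price term \<open>l\<close> in the cost is the slope \<open>-l\<close> in the gain.\<close>

lemma follower_argmin_iff_gain_maximal:
  assumes x: "x \<in> carrier_vec n" and l: "l \<in> carrier_vec n"
  shows "x \<in> follower_argmin n \<phi> l \<longleftrightarrow>
    (\<forall>z\<in>carrier_vec n. ereal (- l \<bullet> z) - \<phi> z \<le> ereal (- l \<bullet> x) - \<phi> x)"
proof -
  have "ereal (- l \<bullet> z) - \<phi> z \<le> ereal (- l \<bullet> x) - \<phi> x \<longleftrightarrow>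
      \<phi> x + ereal (l \<bullet> x) \<le> \<phi> z + ereal (l \<bullet> z)" if z: "z \<in> carrier_vec n" for z
    using x l z by (cases "\<phi> x"; cases "\<phi> z") auto
  then show ?thesis
    using x by (auto simp: follower_argmin_def argmin_set_def is_arg_min_def not_less)
qed

text \<open>
  Some point has a gain above \<open>-\<infinity>\<close>, which a point of infinite cost cannot match.
\<close>

lemma gain_maximal_imp_finite:
  assumes proper: "proper_fn n \<phi>" and x: "x \<in> carrier_vec n"
    and maximal: "\<forall>z\<in>carrier_vec n. ereal (y \<bullet> z) - \<phi> z \<le> ereal (y \<bullet> x) - \<phi> x"
  shows "\<exists>a. \<phi> x = ereal a"
proof -
  obtain z where z: "z \<in> carrier_vec n" "\<phi> z \<noteq> \<infinity>" "\<phi> z \<noteq> -\<infinity>"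
    using proper by (auto simp: proper_fn_def)
  have "ereal (y \<bullet> z) - \<phi> z \<le> ereal (y \<bullet> x) - \<phi> x"
    using maximal z(1) by blast
  moreover have "\<phi> x \<noteq> -\<infinity>"
    using proper x by (auto simp: proper_fn_def)
  ultimately show ?thesis
    using z by (cases "\<phi> x"; cases "\<phi> z") auto
qed

text \<open>
  Where \<open>\<phi> x\<close> is finite, expanding \<open>y \<bullet> (z - x)\<close> turns the subgradient inequality at \<open>z\<close> into
  the maximality inequality at \<open>z\<close>.  Where it is infinite, both sides fail.
\<close>

lemma subdifferential_iff_gain_maximal:
  assumes proper: "proper_fn n \<phi>" and x: "x \<in> carrier_vec n" and y: "y \<in> carrier_vec n"
  shows "y \<in> subdifferential n \<phi> x \<longleftrightarrow>
    (\<forall>z\<in>carrier_vec n. ereal (y \<bullet> z) - \<phi> z \<le> ereal (y \<bullet> x) - \<phi> x)"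
proof (cases "\<exists>a. \<phi> x = ereal a")
  case True
  then obtain a where a: "\<phi> x = ereal a" by blast
  have "ereal (y \<bullet> z) - \<phi> z \<le> ereal (y \<bullet> x) - \<phi> x \<longleftrightarrow>
      \<phi> x + ereal (y \<bullet> (z - x)) \<le> \<phi> z" if z: "z \<in> carrier_vec n" for z
    using a scalar_prod_minus_distrib[OF y z x] by (cases "\<phi> z") auto
  then show ?thesis
    using a x y by (auto simp: subdifferential_def)
next
  case False
  have "\<phi> x \<noteq> -\<infinity>"
    using proper x by (auto simp: proper_fn_def)
  with False have "\<phi> x = \<infinity>" by (cases "\<phi> x") auto
  then have "y \<notin> subdifferential n \<phi> x" by (simp add: subdifferential_def)
  then show ?thesis
    using gain_maximal_imp_finite[OF proper x] False by blast
qed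

text \<open>
  The equality case of the Fenchel--Young inequality: the conjugate is never below the gain
  at \<open>x\<close>, and it equals this gain exactly when no point has a larger one.
\<close>

lemma fenchel_young_div_eq_0_iff_gain_maximal:
  assumes proper: "proper_fn n \<phi>" and x: "x \<in> carrier_vec n"
  shows "fenchel_young_div n \<phi> x y = 0 \<longleftrightarrow>
    (\<forall>z\<in>carrier_vec n. ereal (y \<bullet> z) - \<phi> z \<le> ereal (y \<bullet> x) - \<phi> x)"
proof (cases "\<exists>a. \<phi> x = ereal a")
  case True
  then obtain a where a: "\<phi> x = ereal a" by blast
  have lower: "ereal (y \<bullet> x) - \<phi> x \<le> conjugate_fn n \<phi> y"
    unfolding conjugate_fn_def using x by (rule SUP_upper)
  have "fenchel_young_div n \<phi> x y = 0 \<longleftrightarrow> conjugate_fn n \<phi> y = ereal (y \<bullet> x) - \<phi> x"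
    unfolding fenchel_young_div_def a by (cases "conjugate_fn n \<phi> y") (auto simp: zero_ereal_def)
  also have "\<dots> \<longleftrightarrow> conjugate_fn n \<phi> y \<le> ereal (y \<bullet> x) - \<phi> x"
    using lower by (auto intro: antisym)
  also have "\<dots> \<longleftrightarrow> (\<forall>z\<in>carrier_vec n. ereal (y \<bullet> z) - \<phi> z \<le> ereal (y \<bullet> x) - \<phi> x)"
    unfolding conjugate_fn_def by (rule SUP_le_iff)
  finally show ?thesis .
next
  case False
  have "\<phi> x \<noteq> -\<infinity>"
    using proper x by (auto simp: proper_fn_def)
  with False have "\<phi> x = \<infinity>" by (cases "\<phi> x") auto
  then have "fenchel_young_div n \<phi> x y \<noteq> 0" by (simp add: fenchel_young_div_def)
  then show ?thesis
    using gain_maximal_imp_finite[OF proper x] False by blast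
qed

theorem theorem1:
  fixes n :: "'h::finite \<Rightarrow> nat"
    and X :: "'h \<Rightarrow> real Matrix.vec set"
    and Q :: "'h \<Rightarrow> real mat"
    and q :: "'h \<Rightarrow> real Matrix.vec"
    and \<phi> :: "'h \<Rightarrow> real Matrix.vec \<Rightarrow> ereal"
    and lam :: "'h \<Rightarrow> real ^ 't::finite \<Rightarrow> real Matrix.vec"
    and lo hi :: "'h \<Rightarrow> real"
    and C D :: "((real ^ 't) ^ 'h) set"
    and F :: "('h \<Rightarrow> real Matrix.vec) \<Rightarrow> (real ^ 't) ^ 'h \<Rightarrow> real"
  assumes D: "D = price_box lo hi \<inter> C" "convex C"
    and X: "\<And>i. X i \<subseteq> carrier_vec (n i)" "\<And>i. X i \<noteq> {}"
      "\<And>i. closedin (vec_topology (n i)) (X i)" "\<And>i. convex_vec_set (X i)"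
    and Q: "\<And>i. psd_mat (n i) (Q i)"
    and q: "\<And>i. q i \<in> carrier_vec (n i)"
    and \<phi>: "\<And>i. \<phi> i = follower_cost (X i) (Q i) (q i)"
      "\<And>i. proper_fn (n i) (\<phi> i)" "\<And>i. closed_fn (n i) (\<phi> i)" "\<And>i. convex_fn (n i) (\<phi> i)"
    and lam: "\<And>i. affine_map (n i) (lam i)"
    and attained:
      "\<And>\<delta> i. \<delta> \<in> D \<Longrightarrow> follower_argmin (n i) (\<phi> i) (lam i (vec_nth \<delta> i)) \<noteq> {}"
  shows
    "(\<forall>i. \<forall>x\<in>carrier_vec (n i). \<forall>d.
        (x \<in> follower_argmin (n i) (\<phi> i) (lam i d)
           \<longleftrightarrow> - lam i d \<in> subdifferential (n i) (\<phi> i) x) \<and>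
        (- lam i d \<in> subdifferential (n i) (\<phi> i) x
           \<longleftrightarrow> fenchel_young_div (n i) (\<phi> i) x (- lam i d) = 0) \<and>
        (fenchel_young_div (n i) (\<phi> i) x (- lam i d) = 0
           \<longleftrightarrow> \<phi> i x + conjugate_fn (n i) (\<phi> i) (- lam i d) + ereal (lam i d \<bullet> x) = 0)) \<and>
     bilevel_feasible n \<phi> lam D = single_level_feasible n \<phi> lam D \<and>
     optimal_value (bilevel_feasible n \<phi> lam D) (\<lambda>(x, \<delta>). F x \<delta>)
       = optimal_value (single_level_feasible n \<phi> lam D) (\<lambda>(x, \<delta>). F x \<delta>) \<and>
     argmin_set (bilevel_feasible n \<phi> lam D) (\<lambda>(x, \<delta>). F x \<delta>)
       = argmin_set (single_level_feasible n \<phi> lam D) (\<lambda>(x, \<delta>). F x \<delta>)"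
proof -
  have l: "lam i d \<in> carrier_vec (n i)" "- lam i d \<in> carrier_vec (n i)" for i d
    using lam[of i] by (auto simp: affine_map_def)
  have argmin_iff: "x \<in> follower_argmin (n i) (\<phi> i) (lam i d) \<longleftrightarrow>
      fenchel_young_div (n i) (\<phi> i) x (- lam i d) = 0" if "x \<in> carrier_vec (n i)" for i x d
    using follower_argmin_iff_gain_maximal[OF that l(1)]
      fenchel_young_div_eq_0_iff_gain_maximal[OF \<phi>(2) that] by simp
  have subdiff_iff: "- lam i d \<in> subdifferential (n i) (\<phi> i) x \<longleftrightarrow>
      fenchel_young_div (n i) (\<phi> i) x (- lam i d) = 0" if "x \<in> carrier_vec (n i)" for i x d
    using subdifferential_iff_gain_maximal[OF \<phi>(2) that l(2)]
      fenchel_young_div_eq_0_iff_gain_maximal[OF \<phi>(2) that] by simp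
  have div_eq: "fenchel_young_div (n i) (\<phi> i) x (- lam i d) =
      \<phi> i x + conjugate_fn (n i) (\<phi> i) (- lam i d) + ereal (lam i d \<bullet> x)"
    if "x \<in> carrier_vec (n i)" for i x d
    using that l(1)[of i d] by (simp add: fenchel_young_div_def minus_ereal_def)
  have feasible_eq: "bilevel_feasible n \<phi> lam D = single_level_feasible n \<phi> lam D"
    by (auto simp: bilevel_feasible_def single_level_feasible_def argmin_iff)
  show ?thesis
    by (simp add: argmin_iff subdiff_iff div_eq feasible_eq)
qed

end
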